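(* Let $F=\sum_{\alpha\in\mathbb{F}_n^+}A_{(\alpha)}\otimes Z_\alpha$, $A_{(\alpha)}\in B(\mathcal{K})$, be a formal power series with radius of convergence $R$, and let $R'$ be the radius of convergence of the power series $\dfrac{\partial^kF}{\partial Z_{j_1}\cdots\partial Z_{j_k}}$, where $j_1,\ldots,j_k\in\{1,\ldots,n\}$. Then $R'\ge R$ and, in general, the inequality is strict (that is, there exist power series $F$ and indices for which $R'>R$).
   Context: $\mathbb{F}_n^+$ is the unital free semigroup on generators $g_1,\ldots,g_n$ with identity $g_0$; $|\alpha|$ is word length. $Z_1,\ldots,Z_n$ are noncommuting indeterminates, $Z_\alpha:=Z_{i_1}\cdots Z_{i_k}$ if $\alpha=g_{i_1}\cdots g_{i_k}$, $Z_{g_0}:=I$. $\mathcal{K}$ is a Hilbert space. The radius of convergence $R\in[0,\infty]$ of $\sum_\alpha A_{(\alpha)}\otimes Z_\alpha$ is defined by $\frac1R=\limsup_{k\to\infty}\big\|\sum_{|\alpha|=k}A_{(\alpha)}^*A_{(\alpha)}\big\|^{1/2k}$. The free partial derivation (Hausdorff derivation) $\frac{\partial}{\partial Z_i}$ is the unique linear operator on $\mathbb{C}[Z_1,\ldots,Z_n]$ (noncommutative polynomials) with $\frac{\partial I}{\partial Z_i}=0$, $\frac{\partial Z_i}{\partial Z_i}=I$, $\frac{\partial Z_j}{\partial Z_i}=0$ for $j\ne i$, and $\frac{\partial(fg)}{\partial Z_i}=\frac{\partial f}{\partial Z_i}g+f\frac{\partial g}{\partial Z_i}$; thus $\frac{\partial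 Z_\alpha}{\partial Z_i}$ is the sum of the words obtained by deleting each occurrence of $Z_i$ in $Z_\alpha$. Put $\frac{\partial^kG}{\partial Z_{i_1}\cdots\partial Z_{i_k}}:=\frac{\partial}{\partial Z_{i_1}}\big(\frac{\partial}{\partial Z_{i_2}}\cdots(\frac{\partial G}{\partial Z_{i_k}})\cdots\big)$, and for power series $\frac{\partial^kF}{\partial Z_{i_1}\cdots\partial Z_{i_k}}:=\sum_\alpha A_{(\alpha)}\otimes\frac{\partial^kZ_\alpha}{\partial Z_{i_1}\cdots\partial Z_{i_k}}$. *)

theory Defs
  imports "HOL-Analysis.Analysis" "HOL-Library.Poly_Mapping"
begin

section \<open>Complex Hilbert spaces and their bounded operators\<close>

text \<open>The real inner product is the real part of the complex one, so that the norm and the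
  topology are those of the library classes for real inner product spaces and Banach spaces.\<close>

class complex_hilbert_space = real_inner + banach +
  fixes scaleC :: "complex \<Rightarrow> 'a \<Rightarrow> 'a"  (infixr "*\<^sub>C" 75)
    and cinner :: "'a \<Rightarrow> 'a \<Rightarrow> complex"
  assumes scaleC_add_right: "c *\<^sub>C (x + y) = c *\<^sub>C x + c *\<^sub>C y"
    and scaleC_add_left: "(c + d) *\<^sub>C x = c *\<^sub>C x + d *\<^sub>C x"
    and scaleC_scaleC: "c *\<^sub>C d *\<^sub>C x = (c * d) *\<^sub>C x"
    and scaleC_of_real: "complex_of_real r *\<^sub>C x = r *\<^sub>R x"
    and cinner_add_left: "cinner (x + y) z = cinner x z + cinner y z"
    and cinner_scaleC_left: "cinner (c *\<^sub>C x) y = c * cinner x y"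
    and cinner_commute: "cinner y x = cnj (cinner x y)"
    and Re_cinner: "Re (cinner x y) = x \<bullet> y"

instantiation complex :: complex_hilbert_space
begin

definition scaleC_complex :: "complex \<Rightarrow> complex \<Rightarrow> complex"
  where "scaleC_complex c x = c * x"

definition cinner_complex :: "complex \<Rightarrow> complex \<Rightarrow> complex"
  where "cinner_complex x y = x * cnj y"

instance
  by standard
    (auto simp: scaleC_complex_def cinner_complex_def algebra_simps scaleR_conv_of_real inner_complex_def)

end

lemma norm_scaleC: "norm (c *\<^sub>C x) = cmod c * norm (x :: 'a::complex_hilbert_space)"
proof -
  have im: "cinner x x = complex_of_real (x \<bullet> x)"
    using cinner_commute[of x x] by (auto simp: complex_eq_iff Re_cinner)
  have "cinner (c *\<^sub>C x) (c *\<^sub>C x) = c * cnj c * cinner x x"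
    by (metis cinner_commute cinner_scaleC_left complex_cnj_mult mult.assoc mult.left_commute)
  also have "\<dots> = complex_of_real ((cmod c)\<^sup>2 * (x \<bullet> x))"
    by (simp only: im complex_norm_square of_real_mult)
  finally have "(c *\<^sub>C x) \<bullet> (c *\<^sub>C x) = (cmod c)\<^sup>2 * (x \<bullet> x)"
    by (metis Re_cinner Re_complex_of_real)
  thus ?thesis
    by (simp add: norm_eq_sqrt_inner real_sqrt_mult)
qed

lemma bounded_linear_scaleC: "bounded_linear (\<lambda>x :: 'a::complex_hilbert_space. c *\<^sub>C x)"
proof (rule bounded_linear_intro[where K = "cmod c"])
  show "c *\<^sub>C (r *\<^sub>R x) = r *\<^sub>R (c *\<^sub>C x)" for r and x :: 'a
    by (metis scaleC_of_real scaleC_scaleC mult.commute)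
qed (simp_all add: scaleC_add_right norm_scaleC mult.commute)

text \<open>The type of bounded linear functions of the library only records real-linearity;
  \<open>bounded_ops\<close> is the algebra B(K), with the operator norm of the library.\<close>

definition bounded_ops :: "('a::complex_hilbert_space \<Rightarrow>\<^sub>L 'a) set"
  where "bounded_ops = {T. \<forall>c x. blinfun_apply T (c *\<^sub>C x) = c *\<^sub>C blinfun_apply T x}"

lift_definition scaleC_op :: "complex \<Rightarrow> ('a::complex_hilbert_space \<Rightarrow>\<^sub>L 'a) \<Rightarrow> ('a \<Rightarrow>\<^sub>L 'a)"
  is "\<lambda>c T x. c *\<^sub>C T x"
  using bounded_linear_compose[OF bounded_linear_scaleC] by blast

definition adj :: "('a::complex_hilbert_space \<Rightarrow>\<^sub>L 'a) \<Rightarrow> ('a \<Rightarrow>\<^sub>L 'a)"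
  where "adj T = (THE S. \<forall>x y. cinner (blinfun_apply T x) y = cinner x (blinfun_apply S y))"

text \<open>The Riesz representation theorem, by minimising \<open>(x \<bullet> x) / 2 - f x\<close>; it shows that \<open>adj\<close> is
  well defined.\<close>

lemma riesz_real:
  fixes f :: "'a::{real_inner,complete_space} \<Rightarrow> real"
  assumes "bounded_linear f"
  obtains z where "\<And>x. f x = x \<bullet> z"
proof -
  interpret f: bounded_linear f by fact
  obtain K where K: "\<And>x. norm (f x) \<le> norm x * K" using f.bounded by blast
  define J where "J x = (x \<bullet> x) / 2 - f x" for x
  have low: "J x \<ge> - (K\<^sup>2 / 2)" for x
  proof -
    have "f x \<le> norm x * K" using K[of x] by simp
    moreover have "0 \<le> (norm x - K)\<^sup>2" by simp
    ultimately show ?thesis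
      unfolding J_def by (simp add: power2_eq_square algebra_simps flip: power2_norm_eq_inner)
  qed
  define m where "m = Inf (range J)"
  have bdd: "bdd_below (range J)" using low by (auto intro!: bdd_belowI[of _ "- (K\<^sup>2 / 2)"])
  have m_le: "m \<le> J x" for x unfolding m_def by (rule cInf_lower) (use bdd in auto)
  have "\<exists>x. J x < m + inverse (real (Suc n))" for n
  proof -
    have "Inf (range J) < m + inverse (real (Suc n))" by (simp add: m_def)
    then show ?thesis using cInf_lessD[of "range J"] by blast
  qed
  then obtain X where X: "\<And>n. J (X n) < m + inverse (real (Suc n))" by metis
  have par: "(norm (x - y))\<^sup>2 = 4 * (J x + J y - 2 * J ((1/2) *\<^sub>R (x + y)))" for x y
    by (simp add: J_def power2_norm_eq_inner f.add f.scaleR inner_commute algebra_simps)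
  have near: "(norm (X p - X q))\<^sup>2 \<le> 8 * inverse (real (Suc N))" if "p \<ge> N" "q \<ge> N" for p q N
  proof -
    have "inverse (real (Suc p)) \<le> inverse (real (Suc N))" "inverse (real (Suc q)) \<le> inverse (real (Suc N))"
      using that by (auto intro: le_imp_inverse_le)
    moreover have "4 * (a + b - 2 * c) \<le> 8 * w"
      if "a < m + u" "b < m + v" "u \<le> w" "v \<le> w" "m \<le> c" for a b c u v w :: real
      using that by argo
    ultimately show ?thesis
      unfolding par using X[of p] X[of q] m_le[of "(1/2) *\<^sub>R (X p + X q)"] by blast
  qed
  have "Cauchy X"
  proof (rule metric_CauchyI)
    fix e :: real assume "e > 0"
    then obtain N where N: "inverse (real (Suc N)) < e\<^sup>2 / 8"
      using reals_Archimedean[of "e\<^sup>2 / 8"] by auto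
    have "dist (X p) (X q) < e" if "p \<ge> N" "q \<ge> N" for p q
    proof -
      have "(norm (X p - X q))\<^sup>2 < e\<^sup>2" using near[OF that] N by linarith
      then show ?thesis using \<open>e > 0\<close> by (simp add: dist_norm power2_less_imp_less)
    qed
    then show "\<exists>M. \<forall>p\<ge>M. \<forall>q\<ge>M. dist (X p) (X q) < e" by blast
  qed
  then obtain z where z: "X \<longlonglongrightarrow> z" using Cauchy_convergent convergent_def by blast
  have "(\<lambda>n. J (X n)) \<longlonglongrightarrow> J z"
    unfolding J_def by (intro tendsto_intros z f.tendsto) simp
  moreover have "(\<lambda>n. m + inverse (real (Suc n))) \<longlonglongrightarrow> m"
    by (rule LIMSEQ_inverse_real_of_nat_add)
  moreover have "\<exists>N. \<forall>n\<ge>N. J (X n) \<le> m + inverse (real (Suc n))"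
    using X less_imp_le by blast
  ultimately have "J z \<le> m"
    by (rule LIMSEQ_le)
  then have min: "J z \<le> J x" for x using m_le[of x] by linarith
  have "f h = h \<bullet> z" for h
  proof (rule ccontr)
    define d where "d = h \<bullet> z - f h"
    define s where "s = h \<bullet> h"
    assume "f h \<noteq> h \<bullet> z"
    then have "d \<noteq> 0" by (simp add: d_def)
    then have "h \<noteq> 0" by (auto simp: d_def)
    then have s: "s > 0" by (simp add: s_def)
    have "J (z + t *\<^sub>R h) = J z + t * d + t\<^sup>2 * s / 2" for t
      by (simp add: J_def d_def s_def f.add f.scaleR inner_commute power2_eq_square algebra_simps)
    from this[of "- d / s"] have "J (z + (- d / s) *\<^sub>R h) = J z + (- d / s) * d + (- d / s)\<^sup>2 * s / 2" .
    moreover have "(- d / s) * d + (- d / s)\<^sup>2 * s / 2 = - (d\<^sup>2 / s) / 2"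
      using s by (simp add: power2_eq_square field_simps)
    ultimately have "d\<^sup>2 / s \<le> 0"
      using min[of "z + (- d / s) *\<^sub>R h"] by argo
    then show False using s \<open>d \<noteq> 0\<close> by (simp add: divide_le_0_iff)
  qed
  then show ?thesis using that by blast
qed

lemma Im_cinner: "Im (cinner x y) = - ((\<i> *\<^sub>C x) \<bullet> y)"
  using Re_cinner[of "\<i> *\<^sub>C x" y] by (simp add: cinner_scaleC_left)

lemma adj_ex1:
  fixes T :: "'a::complex_hilbert_space \<Rightarrow>\<^sub>L 'a"
  assumes "T \<in> bounded_ops"
  shows "\<exists>!S. \<forall>x y. cinner (blinfun_apply T x) y = cinner x (blinfun_apply S y)"
proof -
  have "\<exists>z. \<forall>x. blinfun_apply T x \<bullet> y = x \<bullet> z" for y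
    using riesz_real[of "\<lambda>x. blinfun_apply T x \<bullet> y"]
    by (metis bounded_linear_compose[OF bounded_linear_inner_left blinfun.bounded_linear_right])
  then obtain S where S: "\<And>x y. blinfun_apply T x \<bullet> y = x \<bullet> S y" by metis
  have bl: "bounded_linear S"
  proof (rule bounded_linear_intro[where K = "norm T"])
    show "S (x + y) = S x + S y" for x y
      by (rule vector_eq_rdot[THEN iffD1]) (metis S inner_add_right inner_commute)
    show "S (r *\<^sub>R x) = r *\<^sub>R S x" for r x
      by (rule vector_eq_rdot[THEN iffD1]) (metis S inner_scaleR_right inner_commute)
    show "norm (S y) \<le> norm y * norm T" for y
    proof (cases "S y = 0")
      case False
      have "norm (S y) * norm (S y) = blinfun_apply T (S y) \<bullet> y"
        by (simp add: S flip: power2_norm_eq_inner power2_eq_square)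
      also have "\<dots> \<le> norm (blinfun_apply T (S y)) * norm y" by (rule norm_cauchy_schwarz)
      also have "\<dots> \<le> norm T * norm (S y) * norm y"
        by (intro mult_right_mono norm_blinfun) simp
      finally show ?thesis using False by (simp add: algebra_simps)
    qed simp
  qed
  have "cinner (blinfun_apply T x) y = cinner x (S y)" for x y
  proof (rule complex_eqI)
    show "Re (cinner (blinfun_apply T x) y) = Re (cinner x (S y))" by (simp add: Re_cinner S)
    have "\<i> *\<^sub>C blinfun_apply T x = blinfun_apply T (\<i> *\<^sub>C x)"
      using assms by (simp add: bounded_ops_def)
    then show "Im (cinner (blinfun_apply T x) y) = Im (cinner x (S y))" by (simp add: Im_cinner S)
  qed
  then have ex: "\<forall>x y. cinner (blinfun_apply T x) y = cinner x (blinfun_apply (Blinfun S) y)"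
    by (simp add: bounded_linear_Blinfun_apply[OF bl])
  show ?thesis
  proof (rule ex1I[where a = "Blinfun S"])
    show "\<forall>x y. cinner (blinfun_apply T x) y = cinner x (blinfun_apply (Blinfun S) y)" by (fact ex)
  next
    fix S' assume S': "\<forall>x y. cinner (blinfun_apply T x) y = cinner x (blinfun_apply S' y)"
    have "x \<bullet> blinfun_apply S' y = x \<bullet> blinfun_apply (Blinfun S) y" for x y
      using ex S' by (metis Re_cinner)
    then show "S' = Blinfun S"
      by (metis blinfun_eqI vector_eq_ldot)
  qed
qed


section \<open>Noncommutative polynomials and free partial derivations\<close>

text \<open>The free monoid on the finite type \<open>'n\<close> of generators consists of the words, i.e. lists,
  over \<open>'n\<close>, with concatenation as (additively written) operation. The library turns the finitely
  supported functions on a monoid into its monoid algebra.\<close>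

instantiation list :: (type) monoid_add
begin

definition zero_list :: "'a list" where "zero_list = []"

definition plus_list :: "'a list \<Rightarrow> 'a list \<Rightarrow> 'a list" where "plus_list = (@)"

instance
  by standard (simp_all add: zero_list_def plus_list_def)

end

type_synonym 'n ncpoly = "'n list \<Rightarrow>\<^sub>0 complex"

definition indet :: "'n \<Rightarrow> 'n ncpoly"
  where "indet i = Poly_Mapping.single [i] 1"

definition indet_word :: "'n list \<Rightarrow> 'n ncpoly"
  where "indet_word w = prod_list (map indet w)"

definition scale_poly :: "complex \<Rightarrow> 'n ncpoly \<Rightarrow> 'n ncpoly"
  where "scale_poly c p = Poly_Mapping.map ((*) c) p"

definition is_free_pderiv :: "'n \<Rightarrow> ('n ncpoly \<Rightarrow> 'n ncpoly) \<Rightarrow> bool"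
  where "is_free_pderiv i D \<longleftrightarrow>
    Vector_Spaces.linear scale_poly scale_poly D \<and>
    D 1 = 0 \<and> D (indet i) = 1 \<and> (\<forall>j. j \<noteq> i \<longrightarrow> D (indet j) = 0) \<and>
    (\<forall>f g. D (f * g) = D f * g + f * D g)"

definition free_pderiv :: "'n \<Rightarrow> 'n ncpoly \<Rightarrow> 'n ncpoly"
  where "free_pderiv i = (THE D. is_free_pderiv i D)"

definition free_pderivs :: "'n list \<Rightarrow> 'n ncpoly \<Rightarrow> 'n ncpoly"
  where "free_pderivs js p = foldr free_pderiv js p"

lemma indet_word_eq: "indet_word w = Poly_Mapping.single w 1"
  by (induction w)
    (simp_all add: indet_word_def indet_def mult_single plus_list_def flip: single_one,
     simp add: zero_list_def)

lemma scale_poly_conv_mult: "scale_poly c p = Poly_Mapping.single 0 c * p"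
  unfolding scale_poly_def by (rule mult_map_scale_conv_mult)

lemma lookup_scale_poly [simp]: "Poly_Mapping.lookup (scale_poly c p) w = c * Poly_Mapping.lookup p w"
  by (simp add: scale_poly_def Poly_Mapping.map.rep_eq when_def)

lemma vector_space_scale_poly: "vector_space (scale_poly :: complex \<Rightarrow> 'n ncpoly \<Rightarrow> 'n ncpoly)"
  by unfold_locales (auto intro!: poly_mapping_eqI simp: lookup_add algebra_simps)

lemma scale_poly_mult_left: "scale_poly c (p * q) = scale_poly c p * q"
  by (simp add: scale_poly_conv_mult mult.assoc)

lemma scale_poly_mult_right: "scale_poly c (p * q) = p * scale_poly c q"
proof -
  have comm: "Poly_Mapping.single 0 c * p = p * Poly_Mapping.single 0 c" for p :: "'a ncpoly"
  proof (induction p rule: update_induct)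
    case const
    show ?case by simp
  next
    case (update f a b)
    have "Poly_Mapping.update a b f = Poly_Mapping.single a b + f"
      using update by (intro poly_mapping_eqI)
        (auto simp: lookup_update lookup_add lookup_single when_def in_keys_iff)
    then show ?case
      using update by (simp add: algebra_simps mult_single)
  qed
  show ?thesis
    by (metis comm mult.assoc scale_poly_conv_mult)
qed

lemma ncpoly_sum: "p = (\<Sum>w\<in>Poly_Mapping.keys p. scale_poly (Poly_Mapping.lookup p w) (indet_word w))"
  by (rule poly_mapping_eqI)
    (auto simp: lookup_sum indet_word_eq lookup_single when_def in_keys_iff
      sum.delta' if_distrib cong: if_cong)

text \<open>Deleting each occurrence of \<open>i\<close> in turn.\<close>

fun pderiv_word :: "'n \<Rightarrow> 'n list \<Rightarrow> 'n ncpoly" where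
  "pderiv_word i [] = 0"
| "pderiv_word i (a # w) = (if a = i then indet_word w else 0) + indet a * pderiv_word i w"

lemma pderiv_word_append:
  "pderiv_word i (u @ v) = pderiv_word i u * indet_word v + indet_word u * pderiv_word i v"
  by (induction u) (auto simp: indet_word_def algebra_simps)

lemma free_pderiv_ex:
  "\<exists>D. is_free_pderiv i D \<and> (\<forall>w. D (indet_word w) = pderiv_word i w)"
proof -
  define D where "D p =
    (\<Sum>w\<in>Poly_Mapping.keys p. scale_poly (Poly_Mapping.lookup p w) (pderiv_word i w))" for p
  interpret vs: vector_space "scale_poly :: complex \<Rightarrow> 'a ncpoly \<Rightarrow> 'a ncpoly"
    by (rule vector_space_scale_poly)
  have D_sup: "D p = (\<Sum>w\<in>A. scale_poly (Poly_Mapping.lookup p w) (pderiv_word i w))"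
    if "finite A" "Poly_Mapping.keys p \<subseteq> A" for p A
    unfolding D_def using that
    by (intro sum.mono_neutral_left) (auto simp: in_keys_iff vs.scale_zero_left)
  have D_add: "D (p + q) = D p + D q" for p q
  proof -
    let ?A = "Poly_Mapping.keys p \<union> Poly_Mapping.keys q"
    have "finite ?A" by simp
    then show ?thesis
      using D_sup[of ?A p] D_sup[of ?A q] D_sup[of ?A "p + q"]
      by (simp add: keys_add lookup_add vs.scale_left_distrib sum.distrib)
  qed
  have D_scale: "D (scale_poly c p) = scale_poly c (D p)" for c p
  proof -
    have "Poly_Mapping.keys (scale_poly c p) \<subseteq> Poly_Mapping.keys p"
      by (auto simp: in_keys_iff)
    then show ?thesis
      using D_sup[of "Poly_Mapping.keys p" "scale_poly c p"]
      by (simp add: D_def vs.scale_sum_right)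
  qed
  have D_word: "D (indet_word w) = pderiv_word i w" for w
    by (simp add: D_def indet_word_eq)
  have lin: "Vector_Spaces.linear scale_poly scale_poly D"
    by (simp add: Vector_Spaces.linear_iff vector_space_scale_poly D_add D_scale)
  interpret D: Vector_Spaces.linear scale_poly scale_poly D by (rule lin)
  have prod_words: "D (indet_word u * indet_word v) =
      D (indet_word u) * indet_word v + indet_word u * D (indet_word v)" for u v
  proof -
    have "indet_word u * indet_word v = indet_word (u @ v)"
      by (simp add: indet_word_def)
    then show ?thesis by (simp add: D_word pderiv_word_append)
  qed
  have prod_left: "D (p * indet_word v) = D p * indet_word v + p * D (indet_word v)" for p v
  proof -
    have "D ((\<Sum>w\<in>A. scale_poly (c w) (indet_word w)) * indet_word v) =
      D (\<Sum>w\<in>A. scale_poly (c w) (indet_word w)) * indet_word v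
      + (\<Sum>w\<in>A. scale_poly (c w) (indet_word w)) * D (indet_word v)" for A c
      by (simp add: sum_distrib_right D.sum D.scale prod_words sum.distrib
        vs.scale_right_distrib flip: scale_poly_mult_left)
    from this[of "Poly_Mapping.lookup p" "Poly_Mapping.keys p"] show ?thesis
      by (simp only: ncpoly_sum[symmetric])
  qed
  have prod: "D (p * q) = D p * q + p * D q" for p q
  proof -
    have "D (p * (\<Sum>w\<in>A. scale_poly (c w) (indet_word w))) =
      D p * (\<Sum>w\<in>A. scale_poly (c w) (indet_word w))
      + p * D (\<Sum>w\<in>A. scale_poly (c w) (indet_word w))" for A c
      by (simp add: sum_distrib_left D.sum D.scale prod_left sum.distrib vs.scale_right_distrib
        flip: scale_poly_mult_right)
    from this[of "Poly_Mapping.lookup q" "Poly_Mapping.keys q"] show ?thesis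
      by (simp only: ncpoly_sum[symmetric])
  qed
  have "D 1 = 0" using D_word[of "[]"] by (simp add: indet_word_def)
  moreover have "D (indet j) = (if j = i then 1 else 0)" for j
    using D_word[of "[j]"] by (simp add: indet_word_def)
  ultimately have "is_free_pderiv i D"
    unfolding is_free_pderiv_def using lin prod by auto
  then show ?thesis using D_word by blast
qed

lemma free_pderiv_unique:
  assumes "is_free_pderiv i D" "is_free_pderiv i E"
  shows "D = E"
proof -
  interpret D: Vector_Spaces.linear scale_poly scale_poly D
    using assms(1) by (simp add: is_free_pderiv_def)
  interpret E: Vector_Spaces.linear scale_poly scale_poly E
    using assms(2) by (simp add: is_free_pderiv_def)
  have gen: "D (indet a) = E (indet a)" for a
    using assms by (cases "a = i") (simp_all add: is_free_pderiv_def)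
  have word: "D (indet_word w) = E (indet_word w)" for w
  proof (induction w)
    case Nil
    then show ?case using assms by (simp add: is_free_pderiv_def indet_word_def)
  next
    case (Cons a w)
    have "indet_word (a # w) = indet a * indet_word w" by (simp add: indet_word_def)
    then show ?case using assms Cons gen by (simp add: is_free_pderiv_def)
  qed
  have "D (\<Sum>w\<in>A. scale_poly (c w) (indet_word w)) = E (\<Sum>w\<in>A. scale_poly (c w) (indet_word w))"
    for A c by (simp add: D.sum E.sum D.scale E.scale word)
  from this[of "Poly_Mapping.lookup p" "Poly_Mapping.keys p" for p] have "D p = E p" for p
    by (simp only: ncpoly_sum[symmetric])
  then show ?thesis by blast
qed

lemma is_free_pderiv_free_pderiv: "is_free_pderiv i (free_pderiv i)"
proof -
  obtain D where D: "is_free_pderiv i D" using free_pderiv_ex[of i] by (elim exE conjE)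
  show ?thesis
    unfolding free_pderiv_def by (rule theI[of "is_free_pderiv i", OF D free_pderiv_unique[OF _ D]])
qed

lemma free_pderiv_word: "free_pderiv i (indet_word w) = pderiv_word i w"
proof -
  obtain D where D: "is_free_pderiv i D" "\<forall>w. D (indet_word w) = pderiv_word i w"
    using free_pderiv_ex[of i] by (elim exE conjE)
  show ?thesis
    using free_pderiv_unique[OF is_free_pderiv_free_pderiv[of i] D(1)] D(2) by simp
qed


section \<open>Formal power series with operator coefficients\<close>

text \<open>A formal power series is its family \<open>A\<close> of coefficients. The coefficient of its derivative
  at \<open>Z\<^sub>\<beta>\<close> is obtained by collecting, over the words \<open>\<alpha>\<close>, the contributions of \<open>Z\<^sub>\<beta>\<close> to the
  derivatives of \<open>Z\<^sub>\<alpha>\<close>; only finitely many \<open>\<alpha>\<close> contribute, see \<open>finite_contributions\<close>.\<close>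

definition series_pderivs ::
    "'n::finite list \<Rightarrow> ('n list \<Rightarrow> ('a::complex_hilbert_space \<Rightarrow>\<^sub>L 'a)) \<Rightarrow> 'n list \<Rightarrow> ('a \<Rightarrow>\<^sub>L 'a)"
  where "series_pderivs js A \<beta> =
    (\<Sum>\<alpha> | Poly_Mapping.lookup (free_pderivs js (indet_word \<alpha>)) \<beta> \<noteq> 0.
      scaleC_op (Poly_Mapping.lookup (free_pderivs js (indet_word \<alpha>)) \<beta>) (A \<alpha>))"

lemma length_pderiv_word:
  "v \<in> Poly_Mapping.keys (pderiv_word i w) \<Longrightarrow> Suc (length v) = length w"
proof (induction w arbitrary: v)
  case (Cons a w)
  have "v \<in> Poly_Mapping.keys (if a = i then indet_word w else 0)
      \<union> Poly_Mapping.keys (indet a * pderiv_word i w)"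
    using Cons.prems keys_add[of "if a = i then indet_word w else 0" "indet a * pderiv_word i w"]
    by auto
  then show ?case
  proof (rule UnE)
    assume "v \<in> Poly_Mapping.keys (indet a * pderiv_word i w)"
    then obtain u where "v = [a] + u" "u \<in> Poly_Mapping.keys (pderiv_word i w)"
      using keys_mult[of "indet a" "pderiv_word i w"] by (auto simp: indet_def)
    then show ?thesis using Cons.IH by (simp add: plus_list_def)
  qed (auto simp: indet_word_eq split: if_splits)
qed simp

lemma length_free_pderivs:
  assumes "v \<in> Poly_Mapping.keys (free_pderivs js (indet_word w))"
  shows "length w = length v + length js"
  using assms
proof (induction js arbitrary: v)
  case Nil
  then show ?case by (simp add: free_pderivs_def indet_word_eq)
next
  case (Cons j js)
  let ?p = "free_pderivs js (indet_word w)"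
  interpret D: Vector_Spaces.linear scale_poly scale_poly "free_pderiv j"
    using is_free_pderiv_free_pderiv[of j] by (simp add: is_free_pderiv_def)
  have "free_pderiv j ?p = (\<Sum>u\<in>Poly_Mapping.keys ?p. scale_poly (Poly_Mapping.lookup ?p u) (pderiv_word j u))"
    using arg_cong[OF ncpoly_sum[of ?p], of "free_pderiv j"]
    by (simp only: D.sum D.scale free_pderiv_word)
  moreover have "v \<in> Poly_Mapping.keys (free_pderiv j ?p)"
    using Cons.prems by (simp add: free_pderivs_def)
  ultimately obtain u where u: "u \<in> Poly_Mapping.keys ?p"
      "v \<in> Poly_Mapping.keys (scale_poly (Poly_Mapping.lookup ?p u) (pderiv_word j u))"
    using keys_sum[of "\<lambda>u. scale_poly (Poly_Mapping.lookup ?p u) (pderiv_word j u)"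
        "Poly_Mapping.keys ?p"] by (metis (no_types, lifting) UN_E subsetD)
  then have "v \<in> Poly_Mapping.keys (pderiv_word j u)"
    by (simp add: in_keys_iff)
  then show ?case using length_pderiv_word Cons.IH[OF u(1)] by fastforce
qed

lemma finite_contributions:
  "finite {\<alpha> :: 'n::finite list. Poly_Mapping.lookup (free_pderivs js (indet_word \<alpha>)) \<beta> \<noteq> 0}"
proof (rule finite_subset)
  show "{\<alpha>. Poly_Mapping.lookup (free_pderivs js (indet_word \<alpha>)) \<beta> \<noteq> 0}
      \<subseteq> {\<alpha> :: 'n list. set \<alpha> \<subseteq> UNIV \<and> length \<alpha> = length \<beta> + length js}"
    using length_free_pderivs by (auto simp: in_keys_iff)
qed (rule finite_lists_length_eq, simp)

text \<open>As for \<^const>\<open>conv_radius\<close>, the inverse in \<^typ>\<open>ereal\<close> satisfies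
  \<open>inverse 0 = \<infinity>\<close> and \<open>inverse \<infinity> = 0\<close>.\<close>

definition nc_conv_radius ::
    "('n::finite list \<Rightarrow> ('a::complex_hilbert_space \<Rightarrow>\<^sub>L 'a)) \<Rightarrow> ereal"
  where "nc_conv_radius A =
    inverse (limsup (\<lambda>k. ereal (root (2 * k)
      (norm (\<Sum>\<alpha> | length \<alpha> = k. adj (A \<alpha>) o\<^sub>L A \<alpha>)))))"

end

(* Differentiating by Z_j collects at each word w the coefficients of the words obtained by
   inserting j into w at one of its |w| + 1 positions. For a fixed position the insertion is
   injective, so by the Cauchy-Schwarz inequality the norm of the sum of squares over the words of
   length k grows only by the polynomial factor (k + 1)^2, apart from the shift from k to k + 1,
   and neither affects the limsup of the 2k-th roots. The inequality is strict for a series in one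
   of the indeterminates differentiated by another one, where R' is infinite. *)
theory Submission
  imports Defs "HOL-Real_Asymp.Real_Asymp"
begin

section \<open>Coefficients of derivatives\<close>

abbreviation insert_at :: "nat \<Rightarrow> 'n \<Rightarrow> 'n list \<Rightarrow> 'n list"
  where "insert_at p j w \<equiv> take p w @ j # drop p w"

text \<open>Equal lengths force the prefixes before the inserted letter to have equal length, so the
  two words can be compared block by block.\<close>

lemma inj_on_insert_at: "inj_on (insert_at p (j :: 'n)) {w. length w = k}"
proof (rule inj_onI)
  fix v w :: "'n list"
  assume "v \<in> {w. length w = k}" "w \<in> {w. length w = k}" and eq: "insert_at p j v = insert_at p j w"
  then have "length (take p v) = length (take p w)"
    by simp
  with eq have "take p v = take p w" "drop p v = drop p w"
    by simp_all
  then show "v = w"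
    by (metis append_take_drop_id)
qed

lemma lookup_indet_mult:
  "Poly_Mapping.lookup (indet a * p) w =
    (case w of [] \<Rightarrow> 0 | b # v \<Rightarrow> if a = b then Poly_Mapping.lookup p v else 0)"
proof -
  have word: "indet a * scale_poly c (indet_word v) = Poly_Mapping.single (a # v) c" for c v
    by (simp add: indet_word_eq indet_def scale_poly_conv_mult mult_single plus_list_def zero_list_def)
  have "indet a * (\<Sum>v\<in>A. scale_poly (c v) (indet_word v)) = (\<Sum>v\<in>A. Poly_Mapping.single (a # v) (c v))"
    for A and c :: "'a list \<Rightarrow> complex"
    by (simp add: sum_distrib_left word)
  from this[of "Poly_Mapping.lookup p" "Poly_Mapping.keys p"]
  have "indet a * p = (\<Sum>v\<in>Poly_Mapping.keys p. Poly_Mapping.single (a # v) (Poly_Mapping.lookup p v))"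
    by (simp only: ncpoly_sum[symmetric])
  then show ?thesis
    by (auto simp: lookup_sum lookup_single when_def in_keys_iff split: list.split)
qed

text \<open>Deleting an occurrence of \<open>j\<close> from \<open>u\<close> leaves \<open>w\<close>
  exactly when inserting \<open>j\<close> into \<open>w\<close> at that place restores
  \<open>u\<close>. Positions rather than words are counted: next to a run of \<open>j\<close>
  several positions give the same word, and the coefficient is that multiplicity.\<close>

lemma lookup_pderiv_word:
  "Poly_Mapping.lookup (pderiv_word j u) w = (\<Sum>p\<le>length w. if u = insert_at p j w then 1 else 0)"
proof (induction u arbitrary: w)
  case Nil
  then show ?case by simp
next
  case (Cons a u)
  show ?case
  proof (cases w)
    case Nil
    then show ?thesis
      by (auto simp: lookup_add lookup_indet_mult indet_word_eq lookup_single when_def)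
  next
    case (Cons b v)
    \<comment> \<open>Position 0 is split off; every later position lies behind \<open>b\<close> and
      is an insertion into \<open>v\<close>. This mirrors the two summands of
      \<open>pderiv_word\<close>.\<close>
    have "(\<Sum>p\<le>length w. if a # u = insert_at p j w then 1 else 0 :: complex) =
        (if a # u = j # w then 1 else 0) +
        (\<Sum>p\<le>length v. if a # u = b # insert_at p j v then 1 else 0)"
      by (simp only: Cons list.size(4) add_Suc_right add_0_right sum.atMost_Suc_shift
        take_Suc_Cons drop_Suc_Cons take_0 drop_0 append_Cons append_Nil)
    moreover have "Poly_Mapping.lookup (pderiv_word j (a # u)) w =
        (if a # u = j # w then 1 else 0) +
        (if a = b then Poly_Mapping.lookup (pderiv_word j u) v else 0)"
      using Cons by (auto simp: lookup_add lookup_indet_mult indet_word_eq lookup_single when_def)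
    ultimately show ?thesis
      by (simp add: Cons.IH)
  qed
qed

lemma lookup_free_pderiv:
  "Poly_Mapping.lookup (free_pderiv j P) w =
    (\<Sum>p\<le>length w. Poly_Mapping.lookup P (insert_at p j w))"
proof -
  interpret D: Vector_Spaces.linear scale_poly scale_poly "free_pderiv j"
    using is_free_pderiv_free_pderiv[of j] by (simp add: is_free_pderiv_def)
  have "free_pderiv j P =
      (\<Sum>u\<in>Poly_Mapping.keys P. scale_poly (Poly_Mapping.lookup P u) (pderiv_word j u))"
    using arg_cong[OF ncpoly_sum[of P], of "free_pderiv j"]
    by (simp only: D.sum D.scale free_pderiv_word)
  then have "Poly_Mapping.lookup (free_pderiv j P) w =
      (\<Sum>u\<in>Poly_Mapping.keys P. \<Sum>p\<le>length w.
        if u = insert_at p j w then Poly_Mapping.lookup P u else 0)"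
    by (simp add: lookup_sum lookup_pderiv_word sum_distrib_left if_distrib cong: if_cong)
  also have "\<dots> = (\<Sum>p\<le>length w. \<Sum>u\<in>Poly_Mapping.keys P.
        if u = insert_at p j w then Poly_Mapping.lookup P u else 0)"
    by (rule sum.swap)
  also have "\<dots> = (\<Sum>p\<le>length w. Poly_Mapping.lookup P (insert_at p j w))"
    \<comment> \<open>If the inserted word is not a key of \<open>P\<close>, the inner sum has no
      nonzero term, in agreement with its zero coefficient.\<close>
    by (intro sum.cong refl) (simp add: sum.delta' in_keys_iff)
  finally show ?thesis .
qed

section \<open>From polynomials to series with operator coefficients\<close>

lemma finite_words: "finite {w :: 'n::finite list. length w = k}"
  using finite_lists_length_eq[of "UNIV :: 'n set" k] by simp

lemma scaleC_op_0 [simp]: "scaleC_op 0 T = 0"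
  by (rule blinfun_eqI) (simp add: scaleC_op.rep_eq scaleC_of_real[of 0, simplified])

lemma scaleC_op_1 [simp]: "scaleC_op 1 T = T"
  by (rule blinfun_eqI) (simp add: scaleC_op.rep_eq scaleC_of_real[of 1, simplified])

lemma scaleC_op_add: "scaleC_op (c + d) T = scaleC_op c T + scaleC_op d T"
  by (rule blinfun_eqI) (simp add: scaleC_op.rep_eq blinfun.add_left scaleC_add_left)

lemma scaleC_op_sum: "scaleC_op (sum f S) T = (\<Sum>p\<in>S. scaleC_op (f p) T)"
  by (induction S rule: infinite_finite_induct) (simp_all add: scaleC_op_add)

text \<open>Each derivation removes one letter, so only words of this length contribute; the added
  terms have scalar 0. The index set now depends only on lengths, which allows sums to be
  interchanged.\<close>

lemma series_pderivs_eq_sum_words: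
  "series_pderivs js A w = (\<Sum>u | length u = length w + length js.
    scaleC_op (Poly_Mapping.lookup (free_pderivs js (indet_word u)) w) (A u))"
  unfolding series_pderivs_def
  by (rule sum.mono_neutral_left) (use length_free_pderivs in \<open>auto simp: finite_words in_keys_iff\<close>)

lemma series_pderivs_Nil [simp]: "series_pderivs [] A = A"
proof
  fix w
  show "series_pderivs [] A w = A w"
    by (simp add: series_pderivs_eq_sum_words free_pderivs_def indet_word_eq lookup_single when_def
      if_distrib[of "\<lambda>c. scaleC_op c _"] finite_words cong: if_cong)
qed

text \<open>The head \<open>j\<close> is the outermost derivation, so the coefficient formula for a
  single derivation applies to the polynomials already differentiated along
  \<open>js\<close>.\<close>

lemma series_pderivs_Cons:
  "series_pderivs (j # js) A w = (\<Sum>p\<le>length w. series_pderivs js A (insert_at p j w))"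
proof -
  have "series_pderivs (j # js) A w = (\<Sum>u | length u = length w + length (j # js).
      \<Sum>p\<le>length w. scaleC_op (Poly_Mapping.lookup (free_pderivs js (indet_word u)) (insert_at p j w)) (A u))"
    unfolding series_pderivs_eq_sum_words
    by (simp add: free_pderivs_def lookup_free_pderiv scaleC_op_sum)
  also have "\<dots> = (\<Sum>p\<le>length w. \<Sum>u | length u = length w + length (j # js).
      scaleC_op (Poly_Mapping.lookup (free_pderivs js (indet_word u)) (insert_at p j w)) (A u))"
    by (rule sum.swap)
  also have "\<dots> = (\<Sum>p\<le>length w. series_pderivs js A (insert_at p j w))"
    by (intro sum.cong refl) (simp add: series_pderivs_eq_sum_words)
  finally show ?thesis .
qed

lemma sum_in_bounded_ops:
  assumes "\<And>p. p \<in> S \<Longrightarrow> T p \<in> bounded_ops"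
  shows "sum T S \<in> bounded_ops"
proof -
  have "(c *\<^sub>C (\<Sum>p\<in>S. blinfun_apply (T p) x)) = (\<Sum>p\<in>S. c *\<^sub>C blinfun_apply (T p) x)" for c x
    using bounded_linear.linear[OF bounded_linear_scaleC] by (rule linear_sum)
  then show ?thesis
    using assms by (simp add: bounded_ops_def blinfun.sum_left)
qed

text \<open>Existence and uniqueness of the adjoint are known for operators in
  \<open>bounded_ops\<close>, so the coefficients of derivatives have to stay there.\<close>

lemma series_pderivs_in_bounded_ops:
  assumes "range A \<subseteq> bounded_ops"
  shows "series_pderivs js A w \<in> bounded_ops"
proof (induction js arbitrary: w)
  case Nil
  show ?case using assms by (simp add: image_subset_iff)
next
  case (Cons j js)
  show ?case unfolding series_pderivs_Cons by (intro sum_in_bounded_ops Cons.IH assms)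
qed

section \<open>Sums of squares of operators\<close>

lemma inner_adj:
  assumes "T \<in> bounded_ops"
  shows "x \<bullet> blinfun_apply (adj T) y = blinfun_apply T x \<bullet> y"
proof -
  have "\<forall>x y. cinner (blinfun_apply T x) y = cinner x (blinfun_apply (adj T) y)"
    unfolding adj_def by (rule theI'[OF adj_ex1[OF assms]])
  then show ?thesis by (metis Re_cinner)
qed

lemma inner_sum_squares:
  assumes "\<And>u. u \<in> S \<Longrightarrow> A u \<in> bounded_ops"
  shows "y \<bullet> blinfun_apply (\<Sum>u\<in>S. adj (A u) o\<^sub>L A u) x = (\<Sum>u\<in>S. blinfun_apply (A u) y \<bullet> blinfun_apply (A u) x)"
  using assms by (simp add: blinfun.sum_left inner_sum_right inner_adj)

lemma sum_norm_squares_le: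
  assumes "\<And>u. u \<in> S \<Longrightarrow> A u \<in> bounded_ops"
  shows "(\<Sum>u\<in>S. (norm (blinfun_apply (A u) x))\<^sup>2) \<le> norm (\<Sum>u\<in>S. adj (A u) o\<^sub>L A u) * (norm x)\<^sup>2"
proof -
  let ?T = "\<Sum>u\<in>S. adj (A u) o\<^sub>L A u"
  have "(\<Sum>u\<in>S. (norm (blinfun_apply (A u) x))\<^sup>2) = x \<bullet> blinfun_apply ?T x"
    by (simp add: inner_sum_squares[OF assms] power2_norm_eq_inner)
  also have "\<dots> \<le> norm x * norm (blinfun_apply ?T x)"
    by (rule norm_cauchy_schwarz)
  also have "\<dots> \<le> norm x * (norm ?T * norm x)"
    by (intro mult_left_mono norm_blinfun) simp
  finally show ?thesis by (simp add: power2_eq_square algebra_simps)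
qed

text \<open>Converse of \<open>sum_norm_squares_le\<close>: a bound on the quadratic form bounds the
  operator norm, by Cauchy-Schwarz for the positive form summing the inner products of
  \<open>A u\<close> y and \<open>A u\<close> x. Together they let operator norms be compared one
  vector at a time.\<close>

lemma norm_sum_squares_le:
  fixes A :: "'i \<Rightarrow> ('a::complex_hilbert_space \<Rightarrow>\<^sub>L 'a)"
  assumes "\<And>u. u \<in> S \<Longrightarrow> A u \<in> bounded_ops" and "C \<ge> 0"
    and le: "\<And>x. (\<Sum>u\<in>S. (norm (blinfun_apply (A u) x))\<^sup>2) \<le> C * (norm x)\<^sup>2"
  shows "norm (\<Sum>u\<in>S. adj (A u) o\<^sub>L A u) \<le> C"
proof (rule norm_blinfun_bound[OF \<open>C \<ge> 0\<close>])
  let ?T = "\<Sum>u\<in>S. adj (A u) o\<^sub>L A u"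
  fix x
  \<comment> \<open>Testing the form against the image of \<open>x\<close> produces the square of
    the norm to be bounded.\<close>
  define y where "y = blinfun_apply ?T x"
  have L2: "L2_set (\<lambda>u. norm (blinfun_apply (A u) z)) S \<le> sqrt C * norm z" for z
  proof -
    have "L2_set (\<lambda>u. norm (blinfun_apply (A u) z)) S \<le> sqrt (C * (norm z)\<^sup>2)"
      unfolding L2_set_def by (rule real_sqrt_le_mono[OF le])
    then show ?thesis by (simp add: real_sqrt_mult)
  qed
  have "norm y * norm y = y \<bullet> y"
    by (simp flip: power2_norm_eq_inner power2_eq_square)
  also have "\<dots> = (\<Sum>u\<in>S. blinfun_apply (A u) y \<bullet> blinfun_apply (A u) x)"
    using inner_sum_squares[of S A y x, OF assms(1)] by (simp only: flip: y_def)
  also have "\<dots> \<le> (\<Sum>u\<in>S. \<bar>norm (blinfun_apply (A u) y)\<bar> * \<bar>norm (blinfun_apply (A u) x)\<bar>)"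
    by (intro sum_mono) (simp add: norm_cauchy_schwarz)
  also have "\<dots> \<le> L2_set (\<lambda>u. norm (blinfun_apply (A u) y)) S * L2_set (\<lambda>u. norm (blinfun_apply (A u) x)) S"
    by (rule L2_set_mult_ineq)
  also have "\<dots> \<le> (sqrt C * norm y) * (sqrt C * norm x)"
    using \<open>C \<ge> 0\<close> by (intro mult_mono L2) (simp_all add: L2_set_nonneg)
  also have "\<dots> = norm y * (C * norm x)"
    using \<open>C \<ge> 0\<close> by (simp add: algebra_simps)
  finally have "norm y * norm y \<le> norm y * (C * norm x)" .
  then show "norm (blinfun_apply ?T x) \<le> C * norm x"
    using \<open>C \<ge> 0\<close> by (cases "norm y = 0") (auto simp flip: y_def simp: mult_le_cancel_left)
qed

section \<open>Effect of one derivation on the homogeneous levels\<close>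

text \<open>The 2k-th roots of these numbers are the terms of the limsup defining
  \<open>nc_conv_radius\<close>.\<close>

definition level_norm :: "('n list \<Rightarrow> ('a::complex_hilbert_space \<Rightarrow>\<^sub>L 'a)) \<Rightarrow> nat \<Rightarrow> real"
  where "level_norm A k = norm (\<Sum>u | length u = k. adj (A u) o\<^sub>L A u)"

lemma level_norm_nonneg: "0 \<le> level_norm A k"
  by (simp add: level_norm_def)

lemma norm_sum_squared_le:
  "(norm (\<Sum>p\<in>S. f p))\<^sup>2 \<le> real (card S) * (\<Sum>p\<in>S. (norm (f p))\<^sup>2)"
proof -
  have "(norm (\<Sum>p\<in>S. f p))\<^sup>2 \<le> (\<Sum>p\<in>S. norm (f p))\<^sup>2"
    by (intro power_mono norm_sum) simp
  also have "\<dots> \<le> real (card S) * (\<Sum>p\<in>S. (norm (f p))\<^sup>2)"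
    using Cauchy_Schwarz_ineq_sum[of "\<lambda>_. 1" "\<lambda>p. norm (f p)" S] by simp
  finally show ?thesis .
qed

text \<open>One factor \<open>Suc k\<close> comes from Cauchy-Schwarz over the insertion positions,
  the other from bounding the contribution of each position by the whole level.\<close>

lemma level_norm_series_pderivs_Cons:
  fixes A :: "'n::finite list \<Rightarrow> ('a::complex_hilbert_space \<Rightarrow>\<^sub>L 'a)"
  assumes "range A \<subseteq> bounded_ops"
  shows "level_norm (series_pderivs (j # js) A) k
    \<le> (real (Suc k))\<^sup>2 * level_norm (series_pderivs js A) (Suc k)"
proof -
  define B where "B = series_pderivs js A"
  have B: "B u \<in> bounded_ops" for u
    unfolding B_def by (rule series_pderivs_in_bounded_ops[OF assms])
  have "(\<Sum>w | length w = k. (norm (blinfun_apply (series_pderivs (j # js) A w) x))\<^sup>2)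
      \<le> (real (Suc k))\<^sup>2 * level_norm B (Suc k) * (norm x)\<^sup>2" for x
  proof -
    define g where "g u = (norm (blinfun_apply (B u) x))\<^sup>2" for u
    have "(\<Sum>w | length w = k. (norm (blinfun_apply (series_pderivs (j # js) A w) x))\<^sup>2)
        \<le> (\<Sum>w | length w = k. real (Suc k) * (\<Sum>p\<le>k. g (insert_at p j w)))"
    proof (rule sum_mono)
      fix w :: "'n list" assume "w \<in> {w. length w = k}"
      then show "(norm (blinfun_apply (series_pderivs (j # js) A w) x))\<^sup>2
          \<le> real (Suc k) * (\<Sum>p\<le>k. g (insert_at p j w))"
        using norm_sum_squared_le[of "\<lambda>p. blinfun_apply (B (insert_at p j w)) x" "{..k}"]
        by (simp add: series_pderivs_Cons blinfun.sum_left g_def flip: B_def)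
    qed
    also have "\<dots> = real (Suc k) * (\<Sum>p\<le>k. \<Sum>w | length w = k. g (insert_at p j w))"
      by (subst sum.swap) (simp only: sum_distrib_left)
    also have "\<dots> \<le> real (Suc k) * (\<Sum>p\<le>k. \<Sum>u | length u = Suc k. g u)"
    proof (intro mult_left_mono sum_mono)
      fix p
      \<comment> \<open>For fixed \<open>p\<close> each word of length \<open>Suc k\<close> arises
        at most once, so this is a partial sum of nonnegative terms.\<close>
      have "(\<Sum>w | length w = k. g (insert_at p j w)) = sum g (insert_at p j ` {w. length w = k})"
        by (simp add: sum.reindex[OF inj_on_insert_at])
      also have "\<dots> \<le> (\<Sum>u | length u = Suc k. g u)"
        by (rule sum_mono2) (auto simp: finite_words g_def)
      finally show "(\<Sum>w | length w = k. g (insert_at p j w)) \<le> (\<Sum>u | length u = Suc k. g u)" .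
    qed simp
    also have "\<dots> = (real (Suc k))\<^sup>2 * (\<Sum>u | length u = Suc k. g u)"
      by (simp add: power2_eq_square)
    also have "\<dots> \<le> (real (Suc k))\<^sup>2 * (level_norm B (Suc k) * (norm x)\<^sup>2)"
      unfolding level_norm_def g_def by (intro mult_left_mono sum_norm_squares_le B) simp
    finally show ?thesis by (simp only: mult.assoc)
  qed
  then show ?thesis
    unfolding level_norm_def[of "series_pderivs (j # js) A"] B_def[symmetric]
    by (intro norm_sum_squares_le series_pderivs_in_bounded_ops assms)
      (simp_all add: level_norm_nonneg)
qed

section \<open>The radius of convergence\<close>

text \<open>For every m above the limsup on the right, \<open>a (Suc k)\<close> is eventually at
  most m to the power 2k + 2. Hence the 2k-th root of \<open>b k\<close> is at most m times the
  2k-th root of a polynomial in k, which tends to 1.\<close>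

lemma limsup_root_shift_le:
  fixes a b :: "nat \<Rightarrow> real"
  assumes nonneg: "\<And>k. 0 \<le> a k" "\<And>k. 0 \<le> b k"
    and le: "\<And>k. b k \<le> (real (Suc k))\<^sup>2 * a (Suc k)"
  shows "limsup (\<lambda>k. ereal (root (2 * k) (b k))) \<le> limsup (\<lambda>k. ereal (root (2 * k) (a k)))"
    (is "_ \<le> ?L")
\<comment> \<open>Comparing real upper bounds leaves nothing to prove when the right-hand limsup is
  infinite.\<close>
proof (rule ereal_le_real)
  fix l :: real
  assume l: "?L \<le> ereal l"
  have "0 \<le> ?L"
    by (intro le_Limsup always_eventually allI) (simp_all add: nonneg real_root_ge_zero)
  from order_trans[OF this l] have "l \<ge> 0"
    by simp
  show "limsup (\<lambda>k. ereal (root (2 * k) (b k))) \<le> ereal l"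
  proof (rule ereal_le_epsilon2)
    fix e :: real
    assume "e > 0"
    \<comment> \<open>The margin \<open>e\<close> gives a strict bound and keeps \<open>m\<close>
      positive even when \<open>l\<close> is 0.\<close>
    define m where "m = l + e"
    have m: "m > 0" using \<open>l \<ge> 0\<close> \<open>e > 0\<close> by (simp add: m_def)
    have "?L < ereal m"
      using \<open>e > 0\<close> by (intro le_less_trans[OF l]) (simp add: m_def)
    then have "eventually (\<lambda>k. ereal (root (2 * k) (a k)) < ereal m) sequentially"
      by (rule Limsup_lessD)
    then have "eventually (\<lambda>k. root (2 * Suc k) (a (Suc k)) < m) sequentially"
      by (subst (asm) eventually_sequentially_Suc[symmetric]) simp
    then have "eventually (\<lambda>k. ereal (root (2 * k) (b k)) \<le>
        ereal (((real k + 1)\<^sup>2 * m\<^sup>2) powr (1 / (2 * real k)) * m)) sequentially"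
      \<comment> \<open>Index 0 is excluded because \<open>root 0\<close> is constantly 0, so the
        root laws fail there.\<close>
      using eventually_gt_at_top[of 0]
    proof eventually_elim
      case (elim k)
      have "a (Suc k) = root (2 * Suc k) (a (Suc k)) ^ (2 * Suc k)"
        by (rule real_root_pow_pos2[symmetric]) (simp_all add: nonneg)
      also have "\<dots> \<le> m ^ (2 * Suc k)"
        using elim by (intro power_mono less_imp_le real_root_ge_zero nonneg) simp
      \<comment> \<open>The surplus \<open>m\<^sup>2\<close> caused by the degree shift joins the
        polynomial factor.\<close>
      also have "\<dots> = m\<^sup>2 * m ^ (2 * k)"
        by (simp add: power2_eq_square)
      finally have "(real (Suc k))\<^sup>2 * a (Suc k) \<le> (real k + 1)\<^sup>2 * (m\<^sup>2 * m ^ (2 * k))"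
        by (intro mult_mono) (simp_all add: nonneg add.commute)
      with le[of k] have "b k \<le> ((real k + 1)\<^sup>2 * m\<^sup>2) * m ^ (2 * k)"
        by (simp only: mult.assoc)
      then have "root (2 * k) (b k) \<le> root (2 * k) (((real k + 1)\<^sup>2 * m\<^sup>2) * m ^ (2 * k))"
        using elim by simp
      also have "\<dots> = root (2 * k) ((real k + 1)\<^sup>2 * m\<^sup>2) * m"
        using elim m by (simp only: real_root_mult) (simp add: real_root_power_cancel)
      also have "\<dots> = ((real k + 1)\<^sup>2 * m\<^sup>2) powr (1 / (2 * real k)) * m"
        using elim m by (simp add: root_powr_inverse)
      finally show ?case by simp
    qed
    then have "limsup (\<lambda>k. ereal (root (2 * k) (b k))) \<le>
        limsup (\<lambda>k. ereal (((real k + 1)\<^sup>2 * m\<^sup>2) powr (1 / (2 * real k)) * m))"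
      by (rule Limsup_mono)
    also have "\<dots> = ereal m"
    proof (rule lim_imp_Limsup)
      have "(\<lambda>k. ((real k + 1)\<^sup>2 * m\<^sup>2) powr (1 / (2 * real k)) * m) \<longlonglongrightarrow> m"
        using m by real_asymp
      then show "(\<lambda>k. ereal (((real k + 1)\<^sup>2 * m\<^sup>2) powr (1 / (2 * real k)) * m)) \<longlonglongrightarrow> ereal m"
        by simp
    qed simp
    finally show "limsup (\<lambda>k. ereal (root (2 * k) (b k))) \<le> ereal l + ereal e"
      by (simp add: m_def)
  qed
qed

lemma nc_conv_radius_series_pderivs_Cons:
  fixes A :: "'n::finite list \<Rightarrow> ('a::complex_hilbert_space \<Rightarrow>\<^sub>L 'a)"
  assumes "range A \<subseteq> bounded_ops"
  shows "nc_conv_radius (series_pderivs js A) \<le> nc_conv_radius (series_pderivs (j # js) A)"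
  unfolding nc_conv_radius_def level_norm_def[symmetric]
proof (rule ereal_inverse_antimono)
  \<comment> \<open>Inversion reverses order only among the nonnegative extended reals.\<close>
  show "0 \<le> limsup (\<lambda>k. ereal (root (2 * k) (level_norm (series_pderivs (j # js) A) k)))"
    by (intro le_Limsup always_eventually allI) (simp_all add: level_norm_nonneg real_root_ge_zero)
qed (intro limsup_root_shift_le level_norm_nonneg level_norm_series_pderivs_Cons assms)

lemma nc_conv_radius_series_pderivs:
  fixes A :: "'n::finite list \<Rightarrow> ('a::complex_hilbert_space \<Rightarrow>\<^sub>L 'a)"
  assumes "range A \<subseteq> bounded_ops"
  shows "nc_conv_radius A \<le> nc_conv_radius (series_pderivs js A)"
proof (induction js)
  case (Cons j js)
  then show ?case using nc_conv_radius_series_pderivs_Cons[OF assms, of js j] by (rule order_trans)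
qed simp

section \<open>An example of strict inequality\<close>

text \<open>\<open>A\<close> is the geometric series in the single indeterminate of \<open>j\<close>
  with identity coefficients. The nonzero vector \<open>x\<close> makes the identity a nonzero
  operator, so the radius of \<open>A\<close> is at most 1.\<close>

lemma nc_conv_radius_strict:
  fixes i j :: "'n::finite" and x :: "'a::complex_hilbert_space"
  assumes "i \<noteq> j" "x \<noteq> 0"
  defines "A \<equiv> \<lambda>w :: 'n list. if set w \<subseteq> {j} then id_blinfun :: 'a \<Rightarrow>\<^sub>L 'a else 0"
  shows "range A \<subseteq> bounded_ops" "nc_conv_radius A < nc_conv_radius (series_pderivs [i] A)"
proof -
  show A: "range A \<subseteq> bounded_ops"
    by (auto simp: A_def bounded_ops_def linear_0[OF bounded_linear.linear[OF bounded_linear_scaleC]])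
  \<comment> \<open>Every inserted word contains \<open>i\<close>, where \<open>A\<close>
    vanishes.\<close>
  have "series_pderivs [i] A w = 0" for w
    using \<open>i \<noteq> j\<close> by (simp add: series_pderivs_Cons A_def)
  then have "nc_conv_radius (series_pderivs [i] A) = \<infinity>"
    by (simp add: nc_conv_radius_def Limsup_const flip: zero_ereal_def)
  moreover have "level_norm A k \<ge> 1" for k
  proof -
    \<comment> \<open>The k-th power of \<open>j\<close> alone already contributes the full square
      of the norm of \<open>x\<close>.\<close>
    have "(norm x)\<^sup>2 = (norm (blinfun_apply (A (replicate k j)) x))\<^sup>2"
      by (auto simp: A_def)
    also have "\<dots> \<le> (\<Sum>u | length u = k. (norm (blinfun_apply (A u) x))\<^sup>2)"
      by (rule member_le_sum) (auto simp: finite_words)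
    also have "\<dots> \<le> level_norm A k * (norm x)\<^sup>2"
      unfolding level_norm_def by (rule sum_norm_squares_le) (use A in auto)
    finally show ?thesis using \<open>x \<noteq> 0\<close> by simp
  qed
  then have "1 \<le> limsup (\<lambda>k. ereal (root (2 * k) (level_norm A k)))"
    \<comment> \<open>The bound starts at k = 1, since the term at k = 0 is \<open>root 0\<close>
      and hence 0.\<close>
    by (intro le_Limsup) (auto intro!: eventually_sequentiallyI[of 1])
  then have "nc_conv_radius A \<le> 1"
    using ereal_inverse_antimono[of 1 "limsup (\<lambda>k. ereal (root (2 * k) (level_norm A k)))"]
    by (simp add: nc_conv_radius_def level_norm_def)
  ultimately show "nc_conv_radius A < nc_conv_radius (series_pderivs [i] A)"
    by auto
qed

theorem theorem1p9:
  shows "(\<forall>(A :: 'n::finite list \<Rightarrow> ('a::complex_hilbert_space \<Rightarrow>\<^sub>L 'a)) js.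
            range A \<subseteq> bounded_ops \<longrightarrow> nc_conv_radius (series_pderivs js A) \<ge> nc_conv_radius A)
       \<and> (CARD('n) \<ge> 2 \<and> (\<exists>x::'a. x \<noteq> 0) \<longrightarrow>
            (\<exists>(A :: 'n list \<Rightarrow> ('a \<Rightarrow>\<^sub>L 'a)) js.
              range A \<subseteq> bounded_ops \<and> nc_conv_radius (series_pderivs js A) > nc_conv_radius A))"
proof (intro conjI allI impI)
  fix A :: "'n list \<Rightarrow> ('a \<Rightarrow>\<^sub>L 'a)" and js
  assume "range A \<subseteq> bounded_ops"
  then show "nc_conv_radius (series_pderivs js A) \<ge> nc_conv_radius A"
    by (rule nc_conv_radius_series_pderivs)
next
  assume *: "CARD('n) \<ge> 2 \<and> (\<exists>x::'a. x \<noteq> 0)"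
  then obtain x :: 'a where "x \<noteq> 0" by blast
  have "\<not> CARD('n) \<le> Suc 0"
    using * by simp
  then obtain i j :: 'n where "i \<noteq> j"
    using card_le_Suc0_iff_eq[of "UNIV :: 'n set"] by auto
  then show "\<exists>(A :: 'n list \<Rightarrow> ('a \<Rightarrow>\<^sub>L 'a)) js.
      range A \<subseteq> bounded_ops \<and> nc_conv_radius (series_pderivs js A) > nc_conv_radius A"
    using nc_conv_radius_strict[OF _ \<open>x \<noteq> 0\<close>, of i j] by iprover
qed

end
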